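(* Let $p$ be a prime and let $G$ be a finite $p$-group of rank $n$. Then: (1) The number of subgroups of $G$ that contain the Frattini subgroup $\Phi(G)$ is $S_{n,p}$. (2) For each integer $k$ with $0\le k\le n$, the number of subgroups of $G$ with intersection number $n-k$ is $\binom{n}{k}_p$. (3) For each integer $k$ with $0\le k\le n$, the number of subgroups $H$ of $G$ that contain $\Phi(G)$ and whose dimension modulo the Frattini subgroup is $k$ (that is, $\dim_{\mathbb{F}_p} H/\Phi(G)=k$) is $\binom{n}{k}_p$.
   Context: For a prime power $q$ and integers $0\le k\le n$, the Gaussian binomial coefficient is $\binom{n}{k}_q=\frac{(q^n-1)(q^n-q)\cdots(q^n-q^{k-1})}{(q^k-1)(q^k-q)\cdots(q^k-q^{k-1})}$ if $1\le k\le n$, and $\binom{n}{0}_q=1$. Put $S_{n,q}=\sum_{k=0}^n\binom{n}{k}_q$. A finite $p$-group is a group whose order is a power of the prime $p$. The rank of a group $G$ is the smallest nonnegative integer $n$ such that $G$ can be generated by $n$ elements. A maximal subgroup of $G$ is a proper subgroup not contained in any other proper subgroup. The Frattini subgroup $\Phi(G)$ is the intersection of all maximal subgroups of $G$ (equal to $G$ if there are none). For a finite $p$-group $G$ of rank $n$, $\Phi(G)$ is normal in $G$ and $G/\Phi(G)$ is an elementary abelian $p$-group of rank $n$, identified with the vector space $\mathbb{F}_p^n$; its subgroups are the same as its $\mathbb{F}_p$-subspaces. If a subgroup $H$ of $G$ is expressible as an intersection of maximal subgroups, its intersection number is the smallest positive integer $m$ such that $H$ is the intersection of $m$ maximal subgroups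 of $G$; by convention, the intersection number of $G$ itself is $0$. Other subgroups have no intersection number. *)

theory Defs
  imports
    "Jordan_Normal_Form.Missing_VectorSpace"
    "HOL-Algebra.Generated_Groups"
    "HOL-Number_Theory.Residues"
begin

text \<open>The defining quotient of products is kept as a rational number, so that no truncated
  subtraction or division enters.  For \<open>k = 0\<close> both products are empty and the value is \<open>1\<close>.\<close>

definition gaussian_binomial :: "nat \<Rightarrow> nat \<Rightarrow> nat \<Rightarrow> rat" where
  "gaussian_binomial q n k =
     (\<Prod>i<k. of_nat q ^ n - of_nat q ^ i) / (\<Prod>i<k. of_nat q ^ k - of_nat q ^ i)"

definition gaussian_sum :: "nat \<Rightarrow> nat \<Rightarrow> rat" where
  "gaussian_sum q n = (\<Sum>k\<le>n. gaussian_binomial q n k)"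

definition finite_p_group :: "nat \<Rightarrow> ('a, 'b) monoid_scheme \<Rightarrow> bool" where
  "finite_p_group p G \<longleftrightarrow> group G \<and> finite (carrier G) \<and> (\<exists>a. Coset.order G = p ^ a)"

text \<open>Only meaningful for finitely generated groups, where the least number exists.\<close>

definition group_rank :: "('a, 'b) monoid_scheme \<Rightarrow> nat" where
  "group_rank G =
     (LEAST n. \<exists>A. A \<subseteq> carrier G \<and> finite A \<and> card A = n \<and> generate G A = carrier G)"

definition maximal_subgroup :: "('a, 'b) monoid_scheme \<Rightarrow> 'a set \<Rightarrow> bool" where
  "maximal_subgroup G M \<longleftrightarrow>
     subgroup M G \<and> M \<noteq> carrier G \<and>
     (\<forall>K. subgroup K G \<and> K \<noteq> carrier G \<and> M \<subseteq> K \<longrightarrow> K = M)"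

definition frattini :: "('a, 'b) monoid_scheme \<Rightarrow> 'a set" where
  "frattini G =
     (if \<exists>M. maximal_subgroup G M then \<Inter>{M. maximal_subgroup G M} else carrier G)"

definition intersection_of_maximals :: "('a, 'b) monoid_scheme \<Rightarrow> nat \<Rightarrow> 'a set \<Rightarrow> bool" where
  "intersection_of_maximals G m H \<longleftrightarrow>
     (\<exists>F. finite F \<and> card F = m \<and> (\<forall>M\<in>F. maximal_subgroup G M) \<and> H = \<Inter>F)"

text \<open>\<^term>\<open>None\<close> means that the subgroup has no intersection number.  The value \<open>m = 0\<close> is
  excluded from the minimum because \<open>\<Inter>{}\<close> is the whole type, not the group.\<close>

definition intersection_number :: "('a, 'b) monoid_scheme \<Rightarrow> 'a set \<Rightarrow> nat option" where
  "intersection_number G H =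
     (if H = carrier G then Some 0
      else if \<exists>m>0. intersection_of_maximals G m H
        then Some (LEAST m. 0 < m \<and> intersection_of_maximals G m H)
      else None)"

text \<open>An elementary abelian \<open>p\<close>-group \<open>A\<close>, written additively, as a vector space over the field
  of residues modulo \<open>p\<close>, where the residue \<open>a\<close> acts by \<open>x \<mapsto> x\<^sup>a\<close>.  The record type for modules
  extends the one for rings; its multiplicative fields play no role for a module.\<close>

definition fp_space :: "('a, 'b) monoid_scheme \<Rightarrow> (int, 'a) module" where
  "fp_space A =
     \<lparr>carrier = carrier A, monoid.mult = undefined, one = undefined,
      ring.zero = \<one>\<^bsub>A\<^esub>, ring.add = monoid.mult A, module.smult = (\<lambda>a x. x [^]\<^bsub>A\<^esub> a)\<rparr>"

lemma fp_space_vectorspace: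
  assumes p: "prime p" and A: "comm_group A"
    and exp: "\<And>x. x \<in> carrier A \<Longrightarrow> x [^]\<^bsub>A\<^esub> p = \<one>\<^bsub>A\<^esub>"
  shows "vectorspace (residue_ring (int p)) (fp_space A)"
proof -
  interpret A: comm_group A by fact
  have "residues_prime p" using p by (simp add: residues_prime_def)
  then interpret R: residues_prime p "residue_ring (int p)" by simp
  have [simp]: "carrier (fp_space A) = carrier A" "ring.zero (fp_space A) = \<one>\<^bsub>A\<^esub>"
    "ring.add (fp_space A) = monoid.mult A" "\<And>a x. a \<odot>\<^bsub>fp_space A\<^esub> x = x [^]\<^bsub>A\<^esub> a"
    by (simp_all add: fp_space_def)
  have pow_mod: "x [^]\<^bsub>A\<^esub> (a mod int p) = x [^]\<^bsub>A\<^esub> a" if x: "x \<in> carrier A" for x and a :: int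
  proof -
    have "x [^]\<^bsub>A\<^esub> a = x [^]\<^bsub>A\<^esub> (int p * (a div int p) + a mod int p)" by simp
    also have "\<dots> = x [^]\<^bsub>A\<^esub> (int p * (a div int p)) \<otimes>\<^bsub>A\<^esub> x [^]\<^bsub>A\<^esub> (a mod int p)"
      using x by (simp only: A.int_pow_mult)
    also have "x [^]\<^bsub>A\<^esub> (int p * (a div int p)) = \<one>\<^bsub>A\<^esub>"
      using x by (simp add: A.int_pow_pow [symmetric] int_pow_int exp A.int_pow_one)
    finally show ?thesis using x by simp
  qed
  have ab: "abelian_group (fp_space A)"
    by (intro abelian_groupI)
      (auto simp: A.m_ac intro: A.l_inv_ex)
  have "Module.module (residue_ring (int p)) (fp_space A)"
    by (intro Module.moduleI R.cring ab)
      (auto simp: residue_ring_def pow_mod A.int_pow_mult A.int_pow_distrib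
        A.int_pow_pow mult.commute)
  then show ?thesis
    by (simp add: vectorspace_def R.is_field)
qed

text \<open>The dimension of \<open>H / \<Phi>(G)\<close>.  The restriction of \<open>G\<close> to \<open>H\<close> is the subgroup \<open>H\<close>
  regarded as a group.\<close>

definition dim_mod_frattini :: "nat \<Rightarrow> ('a, 'b) monoid_scheme \<Rightarrow> 'a set \<Rightarrow> nat" where
  "dim_mod_frattini p G H =
     vectorspace.dim (residue_ring (int p)) (fp_space ((G\<lparr>carrier := H\<rparr>) Mod frattini G))"

end

theory Submission
  imports
    Defs
    "HOL-Algebra.Group_Action"
    "HOL-Algebra.SndIsomorphismGrp"
    "HOL-Algebra.Multiplicative_Group"
begin

text \<open>In a finite \<open>p\<close>-group every maximal subgroup is normal of index \<open>p\<close>: it acts on its cosets by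
  translation, and counting fixed points modulo \<open>p\<close> shows that its normalizer is strictly larger.
  So \<open>\<Phi> = \<Phi>(G)\<close> contains all commutators and \<open>p\<close>-th powers, and adjoining a new element to a subgroup
  \<open>H \<supseteq> \<Phi>\<close> multiplies its order by \<open>p\<close>.  Subgroups above \<open>\<Phi>\<close> of order \<open>p\<^sup>k |\<Phi>|\<close> are counted through lists
  that are independent modulo \<open>\<Phi>\<close>: a subgroup of order \<open>p\<^sup>m |\<Phi>|\<close> has
  \<open>|\<Phi>|\<^sup>k \<Prod>\<^sub>i (p\<^sup>m - p\<^sup>i)\<close> of them of length \<open>k\<close>, and each list spans exactly one subgroup.
  Intersecting with one more maximal subgroup divides the order by at most \<open>p\<close>, and every
  subgroup of order \<open>p\<^sup>k |\<Phi>|\<close> is an intersection of \<open>n - k\<close> maximal ones.\<close>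

section \<open>Maximal subgroups of finite p-groups\<close>

lemma group_actionI:
  assumes "group G"
    and closed: "\<And>g x. g \<in> carrier G \<Longrightarrow> x \<in> E \<Longrightarrow> f g x \<in> E"
    and one: "\<And>x. x \<in> E \<Longrightarrow> f \<one>\<^bsub>G\<^esub> x = x"
    and mult: "\<And>g h x. g \<in> carrier G \<Longrightarrow> h \<in> carrier G \<Longrightarrow> x \<in> E \<Longrightarrow> f (g \<otimes>\<^bsub>G\<^esub> h) x = f g (f h x)"
  shows "group_action G E (\<lambda>g. restrict (f g) E)"
proof -
  interpret group G by fact
  have Bij: "restrict (f g) E \<in> Bij E" if g: "g \<in> carrier G" for g
  proof -
    have "bij_betw (f g) E E"
      by (rule bij_betw_byWitness[where f' = "f (inv\<^bsub>G\<^esub> g)"])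
        (use g in \<open>auto simp: closed one mult[symmetric]\<close>)
    then show ?thesis by (simp add: Bij_def bij_betw_restrict_eq)
  qed
  have "(\<lambda>g. restrict (f g) E) \<in> hom G (BijGroup E)"
    unfolding hom_def using Bij
    by (auto simp: BijGroup_def compose_def closed mult intro!: restrict_ext)
  then show ?thesis
    by (simp add: group_action_def group_hom_def group_BijGroup group_hom_axioms_def is_group)
qed

text \<open>Orbit sizes divide the group order, so they are powers of \<open>p\<close>. If
  \<open>x\<close> were the only fixed point, all orbits except \<open>{x}\<close> would have size
  divisible by \<open>p\<close>, and \<open>card E\<close> would be 1 modulo
  \<open>p\<close>.\<close>

lemma (in group_action) p_group_second_fixed_point:
  assumes p: "prime p" and order: "order G = p ^ a" and E: "finite E" "p dvd card E"
    and x: "x \<in> E" and fixed: "\<And>g. g \<in> carrier G \<Longrightarrow> \<phi> g x = x"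
  shows "\<exists>y\<in>E. y \<noteq> x \<and> (\<forall>g\<in>carrier G. \<phi> g y = y)"
proof (rule ccontr)
  assume "\<not> ?thesis"
  then have only: "y = x" if "y \<in> E" "\<And>g. g \<in> carrier G \<Longrightarrow> \<phi> g y = y" for y
    using that by (auto simp: Bex_def)
  interpret group G using group_hom group_hom.axioms(1) by auto
  have orb_x: "orbit G \<phi> x = {x}"
  proof
    show "orbit G \<phi> x \<subseteq> {x}" using fixed by (auto simp: orbit_def)
    show "{x} \<subseteq> orbit G \<phi> x" using orbit_refl[OF x] by simp
  qed
  have dvd: "p dvd card orb" if orb: "orb \<in> orbits G E \<phi> - {{x}}" for orb
  proof -
    obtain y where y: "y \<in> E" "orb = orbit G \<phi> y"
      using orb by (auto simp: orbits_def)
    have "card orb dvd p ^ a"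
      using orbit_stabilizer_theorem[OF y(1)] y(2) order by (metis dvd_triv_left)
    then obtain i where i: "card orb = p ^ i"
      using p by (auto simp: divides_primepow_nat)
    \<comment> \<open>An orbit of size \<open>p ^ 0\<close> would be a second fixed point.\<close>
    have "i \<noteq> 0"
    proof
      assume "i = 0"
      then obtain z where "orb = {z}" using i by (auto simp: card_1_singleton_iff)
      then have "orb = {y}" using orbit_refl[OF y(1)] y(2) by simp
      moreover have "\<phi> g y = y" if "g \<in> carrier G" for g
        using \<open>orb = {y}\<close> y(2) that by (auto simp: orbit_def)
      ultimately show False using only[OF y(1)] orb by auto
    qed
    then show ?thesis using i by simp
  qed
  have fin: "finite (orbits G E \<phi>)"
    using E(1) by (simp add: orbits_def)
  have "card E = (\<Sum>orb\<in>orbits G E \<phi>. card orb)"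
    using disjoint_sum[OF E(1), of "\<lambda>_. 1 :: nat"] by simp
  also have "\<dots> = card {x} + (\<Sum>orb\<in>orbits G E \<phi> - {{x}}. card orb)"
    using fin orb_x x by (subst sum.remove[of _ "{x}"]) (auto simp: orbits_def)
  finally have "card E = 1 + (\<Sum>orb\<in>orbits G E \<phi> - {{x}}. card orb)" by simp
  moreover have "p dvd (\<Sum>orb\<in>orbits G E \<phi> - {{x}}. card orb)"
    by (rule dvd_sum) (rule dvd)
  ultimately have "p dvd 1"
    using E(2) by (metis dvd_add_left_iff)
  then show False using p by (simp add: not_prime_unit)
qed

text \<open>\<open>M\<close> acts on its right cosets by right translation and fixes the coset
  \<open>M\<close>. The number of cosets is a positive power of \<open>p\<close>, so a second coset
  \<open>M #> g\<close> is fixed, and its representative \<open>g\<close> conjugates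
  \<open>M\<close> into itself.\<close>

lemma (in group) p_group_normalizer_grows:
  assumes p: "prime p" and order: "order G = p ^ a" and M: "subgroup M G" "M \<noteq> carrier G"
  shows "\<exists>g\<in>carrier G - M. \<forall>m\<in>M. g \<otimes> m \<otimes> inv g \<in> M"
proof -
  have fin: "finite (carrier G)"
    using order p prime_gt_0_nat order_gt_0_iff_finite by simp
  interpret M: subgroup M G by fact
  let ?E = "rcosets M"
  \<comment> \<open>The inverse turns right translation into a left action.\<close>
  let ?f = "\<lambda>m X. X #> inv m"
  interpret act: group_action "G\<lparr>carrier := M\<rparr>" ?E "\<lambda>m. restrict (?f m) ?E"
  proof (rule group_actionI)
    show "group (G\<lparr>carrier := M\<rparr>)" by (rule subgroup_imp_group[OF M(1)])
  next
    fix m X assume "m \<in> carrier (G\<lparr>carrier := M\<rparr>)" "X \<in> ?E"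
    then show "X #> inv m \<in> ?E"
      using M.subset by (auto simp: RCOSETS_def coset_mult_assoc)
  next
    fix X assume "X \<in> ?E"
    then show "X #> inv \<one>\<^bsub>G\<lparr>carrier := M\<rparr>\<^esub> = X"
      using M.rcosets_carrier[OF is_group] by simp
  next
    fix g h X assume "g \<in> carrier (G\<lparr>carrier := M\<rparr>)" "h \<in> carrier (G\<lparr>carrier := M\<rparr>)" "X \<in> ?E"
    then show "X #> inv (g \<otimes>\<^bsub>G\<lparr>carrier := M\<rparr>\<^esub> h) = X #> inv h #> inv g"
      using M.rcosets_carrier[OF is_group] by (simp add: coset_mult_assoc inv_mult_group)
  qed
  have "card M dvd p ^ a" using lagrange[OF M(1)] order by (metis dvd_triv_right)
  then obtain b where b: "card M = p ^ b" using p by (auto simp: divides_primepow_nat)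
  have "card ?E dvd p ^ a" using lagrange[OF M(1)] order by (metis dvd_triv_left)
  then obtain c where c: "card ?E = p ^ c" using p by (auto simp: divides_primepow_nat)
  have "c \<noteq> 0"
  proof
    assume "c = 0"
    then have "card M = card (carrier G)" using lagrange[OF M(1)] c by (simp add: order_def)
    then show False using M(2) card_subset_eq[OF fin M.subset] by simp
  qed
  then have dvd: "p dvd card ?E" using c by simp
  have finE: "finite ?E" using c p by (intro card_ge_0_finite) (simp add: prime_gt_0_nat)
  have "\<exists>Y\<in>?E. Y \<noteq> M \<and> (\<forall>m\<in>carrier (G\<lparr>carrier := M\<rparr>). restrict (?f m) ?E Y = Y)"
  proof (rule act.p_group_second_fixed_point[OF p _ finE dvd, of b M])
    show "order (G\<lparr>carrier := M\<rparr>) = p ^ b" using b by (simp add: order_def)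
    show "M \<in> ?E" by (rule M.subgroup_in_rcosets[OF is_group])
    show "restrict (?f m) ?E M = M" if "m \<in> carrier (G\<lparr>carrier := M\<rparr>)" for m
      using that M.subgroup_in_rcosets[OF is_group] M.rcos_const[OF is_group] by simp
  qed
  then obtain Y where Y: "Y \<in> ?E" "Y \<noteq> M" and fixY: "\<And>m. m \<in> M \<Longrightarrow> restrict (?f m) ?E Y = Y"
    by auto
  obtain g where g: "g \<in> carrier G" "Y = M #> g"
    using Y(1) by (auto simp: RCOSETS_def)
  show ?thesis
  proof (intro bexI ballI)
    show "g \<in> carrier G - M" using Y(2) g M.rcos_const[OF is_group] by blast
    fix m assume m: "m \<in> M"
    \<comment> \<open>Acting with \<open>inv m\<close> translates by \<open>m\<close>
      itself.\<close>
    have "M #> g #> inv (inv m) = M #> g"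
      using fixY[of "inv m"] m Y(1) g by simp
    then have "M #> (g \<otimes> m) = M #> g"
      using m M.subset g by (simp add: coset_mult_assoc)
    then have "g \<otimes> m \<in> M #> g"
      using rcos_self[of "g \<otimes> m" M] m g M(1) by auto
    then obtain m' where "m' \<in> M" "g \<otimes> m = m' \<otimes> g" by (auto simp: r_coset_def)
    then show "g \<otimes> m \<otimes> inv g \<in> M"
      using m g by (simp add: m_assoc)
  qed
qed

text \<open>The normalizer is a subgroup strictly above \<open>M\<close>, so maximality makes it the
  whole group.\<close>

lemma (in group) p_group_maximal_normal:
  assumes p: "prime p" and order: "order G = p ^ a" and max: "maximal_subgroup G M"
  shows "M \<lhd> G"
proof -
  have fin: "finite (carrier G)"
    using order p prime_gt_0_nat order_gt_0_iff_finite by simp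
  have M: "subgroup M G" "M \<noteq> carrier G" using max by (auto simp: maximal_subgroup_def)
  interpret M: subgroup M G by fact
  have finM: "finite M" using fin M.subset finite_subset by blast
  define K where "K = {g \<in> carrier G. \<forall>m\<in>M. g \<otimes> m \<otimes> inv g \<in> M}"
  have K: "subgroup K G"
  proof (rule subgroupI)
    show "K \<noteq> {}" using M.mem_carrier by (auto simp: K_def intro!: exI[of _ \<one>])
  next
    fix g assume g: "g \<in> K"
    have inj: "inj_on (\<lambda>m. g \<otimes> m \<otimes> inv g) M"
      using g by (auto simp: K_def inj_on_def)
    \<comment> \<open>\<open>K\<close> only demands that \<open>g\<close> conjugates
      \<open>M\<close> into \<open>M\<close>. As \<open>M\<close> is finite, this injective map is
      onto, which gives closure of \<open>K\<close> under inverses.\<close>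
    have "(\<lambda>m. g \<otimes> m \<otimes> inv g) ` M = M"
      by (rule endo_inj_surj[OF finM _ inj]) (use g in \<open>auto simp: K_def\<close>)
    then have *: "\<exists>m'\<in>M. m = g \<otimes> m' \<otimes> inv g" if "m \<in> M" for m using that by blast
    have "inv g \<otimes> m \<otimes> g \<in> M" if m: "m \<in> M" for m
    proof -
      obtain m' where m': "m' \<in> M" "m = g \<otimes> m' \<otimes> inv g" using *[OF m] by blast
      then have "inv g \<otimes> m \<otimes> g = m'"
        using g m by (simp add: K_def m_assoc inv_solve_left')
      then show ?thesis using m' by simp
    qed
    then show "inv g \<in> K" using g by (simp add: K_def)
  next
    fix g h assume gh: "g \<in> K" "h \<in> K"
    have "g \<otimes> h \<otimes> m \<otimes> inv (g \<otimes> h) = g \<otimes> (h \<otimes> m \<otimes> inv h) \<otimes> inv g" if "m \<in> M" for m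
      using gh that by (simp add: K_def m_assoc inv_mult_group)
    then show "g \<otimes> h \<in> K" using gh by (auto simp: K_def)
  qed (auto simp: K_def)
  have "M \<subseteq> K" by (auto simp: K_def)
  moreover have "\<exists>g\<in>K. g \<notin> M"
    using p_group_normalizer_grows[OF p order M] by (auto simp: K_def)
  ultimately have "K = carrier G"
    using max K by (auto simp: maximal_subgroup_def)
  then show ?thesis
    using M(1) by (auto simp: K_def normal_inv_iff)
qed

section \<open>Adjoining one element to a normal subgroup\<close>

lemma (in normal) generate_insert:
  assumes x: "x \<in> carrier G"
  shows "generate G (insert x H) = {h \<otimes> x [^] (k::int) | h k. h \<in> H}"
proof -
  interpret S: second_isomorphism_grp H G "generate G {x}"
    by (intro second_isomorphism_grp.intro second_isomorphism_grp_axioms.intro normal_axioms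
        generate_is_subgroup) (use x in simp)
  have eq: "{h \<otimes> x [^] (k::int) | h k. h \<in> H} = H <#> generate G {x}"
    using x by (auto simp: set_mult_def generate_pow)
  have "subgroup {h \<otimes> x [^] (k::int) | h k. h \<in> H} G"
    unfolding eq by (rule S.normal_set_mult_subgroup)
  then show ?thesis
  proof (rule generateI[symmetric])
    have "x = \<one> \<otimes> x [^] (1::int)" using x by (simp add: int_pow_1)
    then have "x \<in> {h \<otimes> x [^] (k::int) | h k. h \<in> H}" using subgroup.one_closed[OF is_subgroup] by blast
    moreover have "h \<in> {h \<otimes> x [^] (k::int) | h k. h \<in> H}" if h: "h \<in> H" for h
    proof -
      have "h = h \<otimes> x [^] (0::int)" using h by simp
      then show ?thesis using h by blast
    qed
    ultimately show "insert x H \<subseteq> {h \<otimes> x [^] (k::int) | h k. h \<in> H}" by blast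
  next
    fix K assume K: "subgroup K G" "insert x H \<subseteq> K"
    then show "{h \<otimes> x [^] (k::int) | h k. h \<in> H} \<subseteq> K"
      by (auto intro!: subgroup.m_closed subgroup_int_pow_closed)
  qed
qed

text \<open>Every element of the larger group is \<open>h \<otimes> x [^] i\<close> with
  \<open>h\<close> in \<open>H\<close> and \<open>i < p\<close> in exactly one way.\<close>

lemma (in normal) card_generate_insert:
  assumes p: "prime p" and x: "x \<in> carrier G" "x \<notin> H" and pow: "x [^] p \<in> H"
  shows "card (generate G (insert x H)) = p * card H"
proof -
  let ?f = "\<lambda>(h, i::nat). h \<otimes> x [^] i"
  have p_int: "x [^] (int p * k) \<in> H" for k
    using subgroup_int_pow_closed[OF is_subgroup pow, of k] x by (simp add: int_pow_pow[symmetric] int_pow_int)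
  have "bij_betw ?f (H \<times> {..<p}) (generate G (insert x H))"
    unfolding bij_betw_def
  proof
    show "inj_on ?f (H \<times> {..<p})"
    proof (rule inj_onI, clarify)
      fix h h' and i j :: nat assume h: "h \<in> H" "h' \<in> H" and ij: "i < p" "j < p"
        and eq: "h \<otimes> x [^] i = h' \<otimes> x [^] j"
      define d where "d = int i - int j"
      have "x [^] d = inv h \<otimes> h'"
      proof -
        have "x [^] d = x [^] i \<otimes> inv (x [^] j)"
          using x by (simp add: d_def int_pow_diff int_pow_int)
        also have "x [^] i = inv h \<otimes> (h' \<otimes> x [^] j)"
          using eq h x by (simp add: inv_solve_left)
        finally show ?thesis using h x by (simp add: m_assoc)
      qed
      then have d: "x [^] d \<in> H" using h by simp
      have "i = j"
      proof (rule ccontr)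
        assume "i \<noteq> j"
        have "\<not> int p dvd d"
        proof
          assume "int p dvd d"
          then have "int p \<le> \<bar>d\<bar>" using \<open>i \<noteq> j\<close> zdvd_imp_le[of "int p" "\<bar>d\<bar>"] by (simp add: d_def)
          then show False using ij by (auto simp: d_def)
        qed
        then have "gcd (int p) d = 1"
          using p by (simp add: prime_imp_coprime coprime_imp_gcd_eq_1)
        \<comment> \<open>Bezout writes \<open>x\<close> as a power of \<open>x [^] p\<close> times
          a power of \<open>x [^] d\<close>. Both factors lie in \<open>H\<close>, but
          \<open>x\<close> does not.\<close>
        then obtain u v where uv: "u * int p + v * d = 1" using bezout_int[of "int p" d] by auto
        have "x = x [^] (int p * u) \<otimes> (x [^] d) [^] v"
        proof -
          have "int p * u + d * v = 1" using uv by (simp add: mult.commute)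
          then have "x = x [^] (int p * u + d * v)" using x by (simp add: int_pow_1)
          then show ?thesis using x by (simp only: int_pow_mult int_pow_pow)
        qed
        then have "x \<in> H"
          using p_int[of u] subgroup_int_pow_closed[OF is_subgroup d, of v] subgroup.m_closed[OF is_subgroup] by metis
        then show False using x by simp
      qed
      with eq h x show "h = h' \<and> i = j" by simp
    qed
  next
    show "?f ` (H \<times> {..<p}) = generate G (insert x H)"
    proof (intro equalityI subsetI)
      fix y assume "y \<in> ?f ` (H \<times> {..<p})"
      then show "y \<in> generate G (insert x H)"
        unfolding generate_insert[OF x(1)] by (auto simp flip: int_pow_int)
    next
      fix y assume "y \<in> generate G (insert x H)"
      then obtain h k where hk: "h \<in> H" "y = h \<otimes> x [^] (k::int)"
        unfolding generate_insert[OF x(1)] by blast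
      \<comment> \<open>The exponent is reduced modulo \<open>p\<close>; the remaining power of
        \<open>x [^] p\<close> is absorbed into the factor from \<open>H\<close>.\<close>
      define i where "i = nat (k mod int p)"
      have p0: "int p > 0" using p by (simp add: prime_gt_0_nat)
      have "i < p" using p0 by (simp add: i_def nat_less_iff)
      have "x [^] k = x [^] (int p * (k div int p) + int i)" using p0 by (simp add: i_def)
      also have "\<dots> = x [^] (int p * (k div int p)) \<otimes> x [^] i"
        using x by (simp only: int_pow_mult int_pow_int)
      finally have "y = (h \<otimes> x [^] (int p * (k div int p))) \<otimes> x [^] i"
        using hk x by (simp add: m_assoc)
      then show "y \<in> ?f ` (H \<times> {..<p})"
        using hk p_int \<open>i < p\<close> by (auto intro!: image_eqI[where x = "(h \<otimes> x [^] (int p * (k div int p)), i)"])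
    qed
  qed
  then have "card (generate G (insert x H)) = card (H \<times> {..<p})"
    by (simp add: bij_betw_same_card)
  then show ?thesis by (simp add: card_cartesian_product)
qed

text \<open>The quotient by \<open>M\<close> has order \<open>p\<close> and is generated by the
  coset of a single element \<open>g\<close>. It therefore has exponent dividing \<open>p\<close>
  and is abelian.\<close>

lemma (in group) p_group_maximal:
  assumes p: "prime p" and order: "order G = p ^ a" and max: "maximal_subgroup G M"
  shows p_group_maximal_pow: "x \<in> carrier G \<Longrightarrow> x [^] p \<in> M"
    and p_group_maximal_commutator:
      "x \<in> carrier G \<Longrightarrow> y \<in> carrier G \<Longrightarrow> x \<otimes> y \<otimes> inv x \<otimes> inv y \<in> M"
proof -
  interpret M: normal M G by (rule p_group_maximal_normal[OF p order max])
  obtain w where w: "w \<in> carrier G" "w \<notin> M"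
    using max M.subset by (auto simp: maximal_subgroup_def)
  have ex: "w [^] (p ^ a) \<in> M"
    using pow_order_eq_1[OF w(1)] order by simp
  \<comment> \<open>Taking \<open>p\<close>-th powers of \<open>w\<close> repeatedly ends in
    \<open>M\<close>. The last power still outside \<open>M\<close> is \<open>g\<close>, so
    \<open>g [^] p\<close> is in \<open>M\<close>, and adjoining \<open>g\<close> to
    \<open>M\<close> gives \<open>G\<close> by maximality.\<close>
  define j where "j = (LEAST j. w [^] (p ^ j) \<in> M)"
  have j: "w [^] (p ^ j) \<in> M" unfolding j_def by (rule LeastI) (rule ex)
  have "j \<noteq> 0" using j w by (metis nat_pow_eone power_0)
  define g where "g = w [^] (p ^ (j - 1))"
  have g: "g \<in> carrier G" "g \<notin> M"
    using not_less_Least[of "j - 1" "\<lambda>j. w [^] (p ^ j) \<in> M"] \<open>j \<noteq> 0\<close> w by (auto simp: g_def j_def)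
  have "g [^] p = w [^] (p ^ (j - 1) * p)" using w by (simp add: g_def nat_pow_pow)
  then have gp: "g [^] p \<in> M" using j \<open>j \<noteq> 0\<close> by (metis power_minus_mult neq0_conv)
  let ?K = "generate G (insert g M)"
  have "subgroup ?K G" using g M.subset by (intro generate_is_subgroup) auto
  moreover have "insert g M \<subseteq> ?K" by (auto intro: generate.incl)
  ultimately have K: "?K = carrier G"
    using max g unfolding maximal_subgroup_def by blast
  have index: "order G = p * card M"
    using M.card_generate_insert[OF p g gp] K by (simp add: order_def)
  have "card M > 0" using order index p by (cases "card M") (auto simp: prime_gt_0_nat)
  then have orderQ: "order (G Mod M) = p"
    using lagrange[OF M.is_subgroup] index by (simp add: order_def FactGroup_def)
  interpret Q: group "G Mod M" by (rule M.factorgroup_is_group)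
  show "x [^] p \<in> M" if x: "x \<in> carrier G"
  proof -
    have "(M #> x) [^]\<^bsub>G Mod M\<^esub> p = M"
      using Q.pow_order_eq_1[of "M #> x"] orderQ x by (simp add: carrier_FactGroup)
    then have "M #> (x [^] p) = M" using M.FactGroup_pow[OF x] by simp
    then show ?thesis using coset_join1[OF _ _ M.is_subgroup] x by simp
  qed
  have coset: "\<exists>k::int. M #> x = M #> (g [^] k)" if "x \<in> carrier G" for x
  proof -
    have "x \<in> {h \<otimes> g [^] (k::int) | h k. h \<in> M}"
      using that K M.generate_insert[OF g(1)] by metis
    then obtain m k where "m \<in> M" "x = m \<otimes> g [^] (k::int)" by blast
    then have "x \<in> M #> (g [^] k)" by (auto simp: r_coset_def)
    then show ?thesis using repr_independence[OF _ _ M.is_subgroup] g by (metis int_pow_closed)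
  qed
  show "x \<otimes> y \<otimes> inv x \<otimes> inv y \<in> M" if x: "x \<in> carrier G" and y: "y \<in> carrier G"
  proof -
    obtain k l :: int where "M #> x = M #> (g [^] k)" "M #> y = M #> (g [^] l)"
      using coset x y by metis
    then have "M #> (x \<otimes> y) = M #> (g [^] (k + l))" "M #> (y \<otimes> x) = M #> (g [^] (l + k))"
      using x y g by (simp_all only: M.rcos_sum[symmetric] int_pow_mult int_pow_closed)
    then have "M #> (x \<otimes> y) = M #> (y \<otimes> x)" by (simp add: add.commute)
    then have "x \<otimes> y \<in> M #> (y \<otimes> x)"
      using rcos_self[of "x \<otimes> y" M] x y M.is_subgroup by auto
    then have "x \<otimes> y \<otimes> inv (y \<otimes> x) \<in> M"
      using M.rcos_module[OF is_group] x y by auto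
    then show ?thesis using x y by (simp add: inv_mult_group m_assoc)
  qed
qed

lemma maximal_subgroup_imp_subgroup: "maximal_subgroup G M \<Longrightarrow> subgroup M G"
  by (simp add: maximal_subgroup_def)

section \<open>Cardinality of finite vector spaces\<close>

text \<open>Coordinates with respect to a basis \<open>B\<close> identify the space with the
  extensional functions from \<open>B\<close> to the field.\<close>

lemma (in vectorspace) card_carrier_eq_power_dim:
  assumes "finite (carrier V)"
  shows "card (carrier V) = card (carrier K) ^ dim"
proof -
  have "fin_dim"
    unfolding fin_dim_def using assms span_is_subset2[of "carrier V"] in_own_span[of "carrier V"]
    by (intro exI[of _ "carrier V"]) auto
  then obtain B where B: "finite B" "basis B" using finite_basis_exists by blast
  have BV: "B \<subseteq> carrier V" using B(2) by (simp add: basis_def)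
  have uniq: "\<forall>v\<in>carrier V. \<exists>!a. a \<in> B \<rightarrow>\<^sub>E carrier K \<and> lincomb a B = v"
    using basis_criterion[OF B(1) BV] B(2) by blast
  have "bij_betw (\<lambda>a. lincomb a B) (B \<rightarrow>\<^sub>E carrier K) (carrier V)"
    unfolding bij_betw_def
  proof
    have closed: "lincomb a B \<in> carrier V" if "a \<in> B \<rightarrow>\<^sub>E carrier K" for a
      using that BV by (intro lincomb_closed) auto
    show "inj_on (\<lambda>a. lincomb a B) (B \<rightarrow>\<^sub>E carrier K)"
    proof (rule inj_onI)
      fix a b assume ab: "a \<in> B \<rightarrow>\<^sub>E carrier K" "b \<in> B \<rightarrow>\<^sub>E carrier K"
        and "lincomb a B = lincomb b B"
      then show "a = b" using bspec[OF uniq closed[OF ab(2)]] by blast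
    qed
    show "(\<lambda>a. lincomb a B) ` (B \<rightarrow>\<^sub>E carrier K) = carrier V"
    proof (intro equalityI subsetI)
      fix v assume "v \<in> carrier V"
      then show "v \<in> (\<lambda>a. lincomb a B) ` (B \<rightarrow>\<^sub>E carrier K)" using uniq by blast
    qed (use closed in blast)
  qed
  then have "card (carrier V) = card (B \<rightarrow>\<^sub>E carrier K)" by (simp add: bij_betw_same_card)
  then show ?thesis using dim_basis[OF B] B(1) by (simp add: card_funcsetE)
qed

section \<open>Subgroups containing the Frattini subgroup\<close>

locale p_group = group G for G (structure) +
  fixes p a :: nat
  assumes p: "prime p" and order: "order G = p ^ a"
begin

abbreviation \<Phi> where "\<Phi> \<equiv> frattini G"

lemma finite_carrier: "finite (carrier G)"
  using order p prime_gt_0_nat order_gt_0_iff_finite by simp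

lemma p_bounds [simp]: "Suc 0 < p" "0 < p" "Suc 0 \<le> p" "p \<noteq> Suc 0"
  using prime_gt_1_nat[OF p] by auto

lemma finite_subgroup: "subgroup H G \<Longrightarrow> finite H"
  using finite_carrier finite_subset subgroup.subset by blast

lemma card_subgroup_pos: "subgroup H G \<Longrightarrow> 0 < card H"
  using finite_subgroup subgroup.one_closed by (fastforce simp: card_gt_0_iff)

text \<open>A description without case distinction: if there is no maximal subgroup, the condition
  is vacuous and the default value \<open>carrier G\<close> results.\<close>

lemma frattini_eq: "\<Phi> = {x \<in> carrier G. \<forall>M. maximal_subgroup G M \<longrightarrow> x \<in> M}"
proof (cases "\<exists>M. maximal_subgroup G M")
  case True
  then have "\<Inter>{M. maximal_subgroup G M} \<subseteq> carrier G"
    by (blast dest: maximal_subgroup_imp_subgroup subgroup.subset)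
  then show ?thesis using True by (auto simp: frattini_def)
qed (auto simp: frattini_def)

lemma frattini_subset_maximal: "maximal_subgroup G M \<Longrightarrow> \<Phi> \<subseteq> M"
  by (auto simp: frattini_eq)

lemma frattini_subgroup: "subgroup \<Phi> G"
proof (rule subgroupI)
  have "\<one> \<in> \<Phi>"
    by (auto simp: frattini_eq maximal_subgroup_imp_subgroup subgroup.one_closed)
  then show "\<Phi> \<noteq> {}" by blast
qed (auto simp: frattini_eq maximal_subgroup_imp_subgroup subgroup.m_closed subgroup.m_inv_closed)

lemma card_frattini_nonzero [simp]: "card \<Phi> \<noteq> 0" "0 < card \<Phi>"
  using card_subgroup_pos[OF frattini_subgroup] by simp_all

lemma generate_frattini: "generate G \<Phi> = \<Phi>"
  using generateI[OF frattini_subgroup, of \<Phi>] by simp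

lemma pow_in_frattini: "x \<in> carrier G \<Longrightarrow> x [^] p \<in> \<Phi>"
  using p_group_maximal_pow[OF p order] by (auto simp: frattini_eq)

lemma commutator_in_frattini:
  "x \<in> carrier G \<Longrightarrow> y \<in> carrier G \<Longrightarrow> x \<otimes> y \<otimes> inv x \<otimes> inv y \<in> \<Phi>"
  using p_group_maximal_commutator[OF p order] by (auto simp: frattini_eq)

text \<open>A conjugate of \<open>h\<close> is a commutator times \<open>h\<close>, and commutators
  lie in \<Phi>.\<close>

lemma normal_if_contains_frattini:
  assumes H: "subgroup H G" "\<Phi> \<subseteq> H"
  shows "H \<lhd> G"
proof -
  have "x \<otimes> h \<otimes> inv x \<in> H" if x: "x \<in> carrier G" and h: "h \<in> H" for x h
  proof -
    have hG: "h \<in> carrier G" using h H subgroup.subset by blast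
    have "x \<otimes> h \<otimes> inv x \<otimes> inv h \<otimes> h \<in> H"
      using commutator_in_frattini[OF x hG] H(2) subgroup.m_closed[OF H(1) _ h] by blast
    then show ?thesis using x hG by (simp add: m_assoc)
  qed
  then show ?thesis using H(1) by (simp add: normal_inv_iff)
qed

lemma subset_generate_insert: "H \<subseteq> generate G (insert x H)" "x \<in> generate G (insert x H)"
  by (auto intro: generate.incl)

lemma subgroup_generate_insert:
  "subgroup H G \<Longrightarrow> x \<in> carrier G \<Longrightarrow> subgroup (generate G (insert x H)) G"
  using subgroup.subset by (intro generate_is_subgroup) auto

lemma card_adjoin:
  assumes "subgroup H G" "\<Phi> \<subseteq> H" "x \<in> carrier G" "x \<notin> H"
  shows "card (generate G (insert x H)) = p * card H"
  using normal.card_generate_insert[OF normal_if_contains_frattini[OF assms(1,2)] p assms(3,4)]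
    pow_in_frattini[OF assms(3)] assms(2) by blast

text \<open>By Lagrange both orders are powers of \<open>p\<close>, and the smaller power divides
  the larger.\<close>

lemma card_subgroup_frattini_multiple:
  assumes "subgroup H G" "\<Phi> \<subseteq> H"
  shows "\<exists>k. card H = p ^ k * card \<Phi>"
proof -
  have pow: "\<exists>i. card K = p ^ i" if "subgroup K G" for K
  proof -
    have "card K dvd p ^ a" using lagrange[OF that] order by (metis dvd_triv_right)
    then show ?thesis using p by (auto simp: divides_primepow_nat)
  qed
  obtain h b where hb: "card H = p ^ h" "card \<Phi> = p ^ b"
    using pow assms(1) frattini_subgroup by blast
  have "card \<Phi> \<le> card H" by (rule card_mono[OF finite_subgroup[OF assms(1)] assms(2)])
  then have "b \<le> h" using hb by simp
  then have "card H = p ^ (h - b) * card \<Phi>" using hb by (simp flip: power_add)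
  then show ?thesis ..
qed

lemma subgroup_eqI:
  assumes "subgroup H G" "K \<subseteq> H" "card H \<le> card K" shows "K = H"
  using assms finite_subgroup card_seteq by blast

text \<open>The dimension of the quotient of \<open>G\<close> by \<Phi>, read off from its order.
  The exponent is unique because \<open>p > 1\<close> and \<Phi> is nonempty;
  \<open>group_rank_eq\<close> identifies it with the rank.\<close>

definition frattini_dim where "frattini_dim = (SOME k. card (carrier G) = p ^ k * card \<Phi>)"

lemma card_carrier: "card (carrier G) = p ^ frattini_dim * card \<Phi>"
proof -
  have "\<exists>k. card (carrier G) = p ^ k * card \<Phi>"
    by (rule card_subgroup_frattini_multiple[OF subgroup_self subgroup.subset[OF frattini_subgroup]])
  then show ?thesis unfolding frattini_dim_def by (rule someI_ex)
qed

text \<open>These correspond to the \<open>k\<close>-dimensional subspaces of the quotient by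
  \<Phi>. All three counts of the theorem are reduced to them.\<close>

definition level :: "nat \<Rightarrow> 'a set set" where
  "level k = {H. subgroup H G \<and> \<Phi> \<subseteq> H \<and> card H = p ^ k * card \<Phi>}"

lemma level_le: "H \<in> level k \<Longrightarrow> k \<le> frattini_dim"
  using card_mono[OF finite_carrier subgroup.subset, of H] card_carrier
  by (auto simp: level_def )

lemma finite_level: "finite (level k)"
  by (rule finite_subset[of _ "Pow (carrier G)"]) (auto simp: level_def finite_carrier dest: subgroup.subset)

lemma card_subgroups_eq_sum: "card {H. subgroup H G \<and> \<Phi> \<subseteq> H} = (\<Sum>k\<le>frattini_dim. card (level k))"
proof -
  have "{H. subgroup H G \<and> \<Phi> \<subseteq> H} = (\<Union>k\<le>frattini_dim. level k)"
  proof (intro equalityI subsetI)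
    fix H assume "H \<in> {H. subgroup H G \<and> \<Phi> \<subseteq> H}"
    moreover from this obtain k where "card H = p ^ k * card \<Phi>"
      using card_subgroup_frattini_multiple by blast
    ultimately have "H \<in> level k" by (simp add: level_def)
    then show "H \<in> (\<Union>k\<le>frattini_dim. level k)" using level_le by blast
  qed (auto simp: level_def)
  also have "card \<dots> = (\<Sum>k\<le>frattini_dim. card (level k))"
    by (rule card_UN_disjoint) (auto simp: finite_level, auto simp: level_def )
  finally show ?thesis .
qed

section \<open>Counting the levels by independent lists\<close>

text \<open>Frames are the lists of length \<open>k\<close> in \<open>H\<close> that are linearly independent modulo the Frattini
  subgroup.\<close>

abbreviation span where "span xs \<equiv> generate G (\<Phi> \<union> set xs)"

fun frames :: "'a set \<Rightarrow> nat \<Rightarrow> 'a list set" where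
  "frames H 0 = {[]}"
| "frames H (Suc k) = (\<lambda>(xs, x). x # xs) ` (SIGMA xs:frames H k. H - span xs)"

lemma generate_insert_generate:
  assumes "A \<subseteq> carrier G" "x \<in> carrier G"
  shows "generate G (insert x (generate G A)) = generate G (insert x A)"
proof (rule generateI[symmetric])
  show "subgroup (generate G (insert x A)) G" "insert x (generate G A) \<subseteq> generate G (insert x A)"
    using assms mono_generate[of A "insert x A"]
    by (auto intro: generate_is_subgroup generate.incl)
  fix K assume "subgroup K G" "insert x (generate G A) \<subseteq> K"
  then show "generate G (insert x A) \<subseteq> K"
    by (intro generate_subgroup_incl) (auto intro: generate.incl)
qed

lemma frames_subset: "xs \<in> frames H k \<Longrightarrow> set xs \<subseteq> H"
  by (induction k arbitrary: xs) fastforce+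

lemma span_subset: "subgroup H G \<Longrightarrow> \<Phi> \<subseteq> H \<Longrightarrow> xs \<in> frames H k \<Longrightarrow> span xs \<subseteq> H"
  using frames_subset by (intro generate_subgroup_incl) auto

text \<open>Each entry lies outside the span of the entries after it, so each multiplies the order
  by \<open>p\<close>, starting from \<Phi>.\<close>

lemma span_in_level:
  assumes "H \<subseteq> carrier G" "xs \<in> frames H k"
  shows "span xs \<in> level k"
  using assms(2)
proof (induction k arbitrary: xs)
  case 0
  then show ?case
    using frattini_subgroup by (simp add: level_def generate_frattini)
next
  case (Suc k)
  then obtain y ys where ys: "xs = y # ys" "ys \<in> frames H k" "y \<in> H" "y \<notin> span ys" by auto
  have sub: "\<Phi> \<union> set ys \<subseteq> carrier G" "y \<in> carrier G"
    using frames_subset[OF ys(2)] assms(1) ys(3) subgroup.subset[OF frattini_subgroup] by auto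
  have "span xs = generate G (insert y (span ys))"
    using generate_insert_generate[OF sub] ys(1) by simp
  then show ?case
    using Suc.IH[OF ys(2)] card_adjoin[of "span ys" y] subgroup_generate_insert[of "span ys" y]
      subset_generate_insert(1)[of "span ys" y] ys(4) sub(2)
    by (auto simp: level_def)
qed

lemma finite_frames: "finite H \<Longrightarrow> finite (frames H k)"
  by (induction k) auto

text \<open>A list of length \<open>k\<close> can be extended by any element of \<open>H\<close>
  outside its span, which has order \<open>p ^ k * card \<Phi>\<close>. Rational arithmetic also
  covers \<open>k > m\<close>, where the factor for \<open>i = m\<close> vanishes.\<close>

lemma card_frames:
  assumes H: "subgroup H G" "\<Phi> \<subseteq> H" "card H = p ^ m * card \<Phi>"
  shows "(of_nat (card (frames H k)) :: rat)
    = of_nat (card \<Phi>) ^ k * (\<Prod>i<k. of_nat p ^ m - of_nat p ^ i)"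
proof (induction k)
  case 0
  then show ?case by simp
next
  case (Suc k)
  let ?c = "of_nat (card \<Phi>) * (of_nat p ^ m - of_nat p ^ k) :: rat"
  have diff: "of_nat (card (H - span xs)) = ?c" if xs: "xs \<in> frames H k" for xs
  proof -
    have sub: "span xs \<subseteq> H" using span_subset[OF H(1,2) xs] .
    then have "card (span xs) \<le> card H" "card (H - span xs) = card H - card (span xs)"
      using finite_subgroup[OF H(1)] by (auto simp: card_mono card_Diff_subset finite_subset)
    moreover have "card (span xs) = p ^ k * card \<Phi>"
      using span_in_level[OF subgroup.subset[OF H(1)] xs] by (simp add: level_def)
    ultimately show ?thesis using H(3) by (simp add: of_nat_diff algebra_simps)
  qed
  have inj: "inj_on (\<lambda>(xs, x). x # xs) A" for A :: "('a list \<times> 'a) set"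
    by (auto simp: inj_on_def)
  have fin: "finite (frames H k)" "finite (H - span xs)" for xs
    using finite_subgroup[OF H(1)] finite_frames by auto
  have "card (frames H (Suc k)) = (\<Sum>xs\<in>frames H k. card (H - span xs))"
    using fin by (simp add: card_image[OF inj] card_SigmaI)
  then have "of_nat (card (frames H (Suc k))) = of_nat (card (frames H k)) * ?c"
    by (simp add: diff del: frames.simps)
  then show ?case unfolding Suc.IH by simp
qed

text \<open>Double counting: every frame of \<open>G\<close> of length \<open>k\<close> is a frame
  of exactly one member of \<open>level k\<close>, namely its span, and all members have equally
  many frames.\<close>

lemma card_level:
  assumes "k \<le> frattini_dim"
  shows "of_nat (card (level k)) = gaussian_binomial p frattini_dim k"
proof -
  let ?c = "of_nat (card \<Phi>) :: rat"
  let ?P = "\<lambda>m. (\<Prod>i<k. of_nat p ^ m - of_nat p ^ i :: rat)"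
  have sub: "\<Phi> \<subseteq> carrier G" using subgroup.subset[OF frattini_subgroup] .
  \<comment> \<open>The span has the same order as \<open>H\<close>. Hence a frame determines
    \<open>H\<close>, and the frame sets of different members are disjoint.\<close>
  have level_frames: "span xs = H" if H: "H \<in> level k" and xs: "xs \<in> frames H k" for H xs
  proof (rule subgroup_eqI)
    show "subgroup H G" "span xs \<subseteq> H" using H xs span_subset by (auto simp: level_def)
    show "card H \<le> card (span xs)"
      using span_in_level[OF subgroup.subset xs] H by (auto simp: level_def)
  qed
  have mono: "frames H k \<subseteq> frames K k" if "H \<subseteq> K" for H K
    using that by (induction k) fastforce+
  \<comment> \<open>The set \<open>H\<close> enters \<open>frames\<close> only as the range of the
    entries, so a frame of \<open>G\<close> is also a frame of any set containing its
    entries.\<close>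
  have self: "xs \<in> frames (span xs) k" if "xs \<in> frames (carrier G) k" for xs
  proof -
    have "\<lbrakk>xs \<in> frames (carrier G) k; set xs \<subseteq> H\<rbrakk> \<Longrightarrow> xs \<in> frames H k" for H
      by (induction k arbitrary: xs) (auto simp: image_iff)
    moreover have "set xs \<subseteq> span xs" by (auto intro: generate.incl)
    ultimately show ?thesis using that by blast
  qed
  have "frames (carrier G) k = (\<Union>H\<in>level k. frames H k)"
  proof (intro equalityI subsetI)
    fix xs assume "xs \<in> frames (carrier G) k"
    then show "xs \<in> (\<Union>H\<in>level k. frames H k)"
      using span_in_level[of "carrier G" xs k] self by auto
  next
    fix xs assume "xs \<in> (\<Union>H\<in>level k. frames H k)"
    then show "xs \<in> frames (carrier G) k"
      using mono[OF subgroup.subset] by (auto simp: level_def)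
  qed
  also have "card \<dots> = (\<Sum>H\<in>level k. card (frames H k))"
  proof (rule card_UN_disjoint)
    show "\<forall>H\<in>level k. finite (frames H k)"
      by (auto simp: level_def finite_frames finite_subgroup)
    show "\<forall>H\<in>level k. \<forall>K\<in>level k. H \<noteq> K \<longrightarrow> frames H k \<inter> frames K k = {}"
      using level_frames by blast
  qed (rule finite_level)
  finally have "of_nat (card (frames (carrier G) k)) = (\<Sum>H\<in>level k. of_nat (card (frames H k)) :: rat)"
    by simp
  also have "\<dots> = of_nat (card (level k)) * (?c ^ k * ?P k)"
    by (simp add: card_frames[of _ k] level_def)
  also have "of_nat (card (frames (carrier G) k)) = ?c ^ k * ?P frattini_dim"
    by (rule card_frames[OF subgroup_self sub card_carrier])
  finally have "?c ^ k * ?P frattini_dim = ?c ^ k * (of_nat (card (level k)) * ?P k)" by simp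
  moreover have "?c \<noteq> 0" using card_subgroup_pos[OF frattini_subgroup] by simp
  ultimately have "?P frattini_dim = of_nat (card (level k)) * ?P k" by simp
  \<comment> \<open>All exponents \<open>i\<close> are below \<open>k\<close>, so no factor vanishes
    and division is legitimate.\<close>
  moreover have "?P k \<noteq> 0"
    by (auto simp flip: of_nat_power)
  ultimately show ?thesis by (simp add: gaussian_binomial_def)
qed

section \<open>The rank as the dimension modulo the Frattini subgroup\<close>

lemma finite_supersets: "finite {K. subgroup K G \<and> P K}"
  by (rule finite_subset[of _ "Pow (carrier G)"]) (auto simp: finite_carrier dest: subgroup.subset)

lemma proper_subgroup_in_maximal:
  assumes "subgroup H G" "H \<noteq> carrier G"
  obtains M where "maximal_subgroup G M" "H \<subseteq> M"
proof -
  have "\<exists>M\<in>{K. subgroup K G \<and> K \<noteq> carrier G}. H \<subseteq> M \<and>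
      (\<forall>K\<in>{K. subgroup K G \<and> K \<noteq> carrier G}. M \<subseteq> K \<longrightarrow> M = K)"
    by (rule finite_has_maximal2[OF finite_supersets]) (use assms in simp)
  then show thesis using that by (auto simp: maximal_subgroup_def)
qed

text \<open>Elements of \<Phi> are non-generators: if \<open>A\<close> generated a proper subgroup,
  some maximal subgroup would contain both \<open>A\<close> and \<Phi>.\<close>

lemma generate_frattini_union:
  assumes A: "A \<subseteq> carrier G" and gen: "generate G (\<Phi> \<union> A) = carrier G"
  shows "generate G A = carrier G"
proof (rule ccontr)
  assume "generate G A \<noteq> carrier G"
  then obtain M where M: "maximal_subgroup G M" "generate G A \<subseteq> M"
    using proper_subgroup_in_maximal[OF generate_is_subgroup[OF A]] by blast
  have "A \<subseteq> M" using M(2) by (auto intro: generate.incl)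
  then have "generate G (\<Phi> \<union> A) \<subseteq> M"
    using frattini_subset_maximal[OF M(1)] maximal_subgroup_imp_subgroup[OF M(1)]
    by (intro generate_subgroup_incl) auto
  then have "M = carrier G"
    using gen subgroup.subset[OF maximal_subgroup_imp_subgroup[OF M(1)]] by blast
  then show False using M(1) by (simp add: maximal_subgroup_def)
qed

lemma generate_frattini_insert:
  assumes "insert x A \<subseteq> carrier G"
  shows "generate G (\<Phi> \<union> insert x A) = generate G (insert x (generate G (\<Phi> \<union> A)))"
  using generate_insert_generate[of "\<Phi> \<union> A" x] assms subgroup.subset[OF frattini_subgroup] by simp

lemma subgroup_generate_frattini_union: "A \<subseteq> carrier G \<Longrightarrow> subgroup (generate G (\<Phi> \<union> A)) G"
  using subgroup.subset[OF frattini_subgroup] by (intro generate_is_subgroup) auto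

text \<open>Each new generator multiplies the order by \<open>p\<close> or leaves the subgroup
  unchanged.\<close>

lemma card_generate_frattini_le:
  assumes "finite A" "A \<subseteq> carrier G"
  shows "card (generate G (\<Phi> \<union> A)) \<le> p ^ card A * card \<Phi>"
  using assms
proof (induction A rule: finite_induct)
  case empty
  then show ?case by (simp add: generate_frattini)
next
  case (insert x A)
  let ?K = "generate G (\<Phi> \<union> A)"
  have K: "subgroup ?K G" "\<Phi> \<subseteq> ?K"
    using insert.prems subgroup_generate_frattini_union by (auto intro: generate.incl)
  have "card (generate G (insert x ?K)) \<le> p * card ?K"
  proof (cases "x \<in> ?K")
    case True
    then have "generate G (insert x ?K) = ?K"
      using generateI[OF K(1), of ?K] by (simp add: insert_absorb)
    then show ?thesis by simp
  next
    case False
    then show ?thesis using card_adjoin[OF K] insert.prems by simp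
  qed
  also have "\<dots> \<le> p * (p ^ card A * card \<Phi>)"
    using insert by (intro mult_left_mono) auto
  finally show ?case
    using insert generate_frattini_insert[OF insert.prems] by (simp add: mult.assoc)
qed

lemma group_rank_eq: "group_rank G = frattini_dim"
  unfolding group_rank_def
proof (rule Least_equality)
  \<comment> \<open>A generating set modulo \<Phi> is built greedily: each chosen element lies
    outside the subgroup reached so far and raises the level by one.\<close>
  have "\<exists>A\<subseteq>carrier G. finite A \<and> card A = j \<and> generate G (\<Phi> \<union> A) \<in> level j" if "j \<le> frattini_dim" for j
    using that
  proof (induction j)
    case 0
    then show ?case
      using frattini_subgroup by (intro exI[of _ "{}"]) (simp add: level_def generate_frattini)
  next
    case (Suc j)
    then obtain A where A: "A \<subseteq> carrier G" "finite A" "card A = j" "generate G (\<Phi> \<union> A) \<in> level j"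
      by auto
    let ?K = "generate G (\<Phi> \<union> A)"
    have K: "subgroup ?K G" "\<Phi> \<subseteq> ?K" "card ?K = p ^ j * card \<Phi>"
      using A(4) by (auto simp: level_def)
    have "?K \<noteq> carrier G" using K(3) card_carrier Suc.prems by auto
    then obtain x where x: "x \<in> carrier G" "x \<notin> ?K" using subgroup.subset[OF K(1)] by blast
    have "x \<notin> A" using x(2) by (auto intro: generate.incl)
    then have "card (insert x A) = Suc j" using A by simp
    moreover have "generate G (\<Phi> \<union> insert x A) \<in> level (Suc j)"
      using generate_frattini_insert[of x A] card_adjoin[OF K(1,2) x] K x(1) A(1)
        subgroup_generate_insert[OF K(1) x(1)] subset_generate_insert(1)[of ?K x]
      by (auto simp: level_def)
    ultimately show ?case using A x(1) by (intro exI[of _ "insert x A"]) simp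
  qed
  then obtain A where A: "A \<subseteq> carrier G" "finite A" "card A = frattini_dim" "generate G (\<Phi> \<union> A) \<in> level frattini_dim"
    by blast
  have "generate G (\<Phi> \<union> A) = carrier G"
    using A(4) card_carrier subgroup.subset
    by (intro subgroup_eqI[OF subgroup_self]) (auto simp: level_def)
  then show "\<exists>A. A \<subseteq> carrier G \<and> finite A \<and> card A = frattini_dim \<and> generate G A = carrier G"
    using A generate_frattini_union by blast
next
  fix m assume "\<exists>A. A \<subseteq> carrier G \<and> finite A \<and> card A = m \<and> generate G A = carrier G"
  then obtain A where A: "A \<subseteq> carrier G" "finite A" "card A = m" "generate G A = carrier G" by blast
  \<comment> \<open>Conversely, \<open>m\<close> generators reach order at most
    \<open>p ^ m * card \<Phi>\<close>, which bounds \<open>m\<close> from below.\<close>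
  have "carrier G \<subseteq> generate G (\<Phi> \<union> A)" using A(4) mono_generate[of A "\<Phi> \<union> A"] by auto
  then have "card (carrier G) \<le> card (generate G (\<Phi> \<union> A))"
    using finite_subgroup[OF subgroup_generate_frattini_union[OF A(1)]] by (simp add: card_mono)
  also have "\<dots> \<le> p ^ m * card \<Phi>"
    using card_generate_frattini_le[OF A(2,1)] A(3) by simp
  finally have "p ^ frattini_dim * card \<Phi> \<le> p ^ m * card \<Phi>" by (simp only: card_carrier)
  then show "frattini_dim \<le> m" by simp
qed

section \<open>Intersections of maximal subgroups\<close>

text \<open>Any strictly larger subgroup contains some \<open>x\<close> outside \<open>M\<close>,
  and adjoining \<open>x\<close> to \<open>M\<close> already yields the order of
  \<open>G\<close>.\<close>

lemma index_p_imp_maximal: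
  assumes M: "subgroup M G" "\<Phi> \<subseteq> M" and index: "card (carrier G) = p * card M"
  shows "maximal_subgroup G M"
  unfolding maximal_subgroup_def
proof (intro conjI allI impI)
  show "subgroup M G" by fact
  show "M \<noteq> carrier G" using index card_subgroup_pos[OF M(1)] by auto
  fix K assume K: "subgroup K G \<and> K \<noteq> carrier G \<and> M \<subseteq> K"
  show "K = M"
  proof (rule ccontr)
    assume "K \<noteq> M"
    then obtain x where x: "x \<in> K" "x \<notin> M" using K by blast
    have "x \<in> carrier G" using x(1) K subgroup.subset by blast
    then have "card (carrier G) = card (generate G (insert x M))"
      using card_adjoin[OF M _ x(2)] index by simp
    moreover have "generate G (insert x M) \<subseteq> K"
      using K x by (intro generate_subgroup_incl) auto
    ultimately have "K = carrier G"
      using K subgroup_eqI[OF subgroup_self subgroup.subset, of K]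
      by (simp add: card_mono finite_subgroup)
    then show False using K by simp
  qed
qed

text \<open>A subgroup that is maximal among those containing \<open>H\<close> and avoiding \<open>x\<close> has index \<open>p\<close>, since
  adjoining \<open>x\<close> to it must already give the whole group.\<close>

lemma maximal_avoiding:
  assumes H: "subgroup H G" "\<Phi> \<subseteq> H" and x: "x \<in> carrier G" "x \<notin> H"
  obtains M where "maximal_subgroup G M" "H \<subseteq> M" "x \<notin> M"
proof -
  have "\<exists>M\<in>{K. subgroup K G \<and> x \<notin> K}. H \<subseteq> M \<and>
      (\<forall>K\<in>{K. subgroup K G \<and> x \<notin> K}. M \<subseteq> K \<longrightarrow> M = K)"
    by (rule finite_has_maximal2[OF finite_supersets]) (use H x in simp)
  then obtain M where M: "subgroup M G" "x \<notin> M" "H \<subseteq> M"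
    and max: "\<And>K. subgroup K G \<Longrightarrow> x \<notin> K \<Longrightarrow> M \<subseteq> K \<Longrightarrow> M = K" by auto
  have frat: "\<Phi> \<subseteq> M" using H M by simp
  let ?K = "generate G (insert x M)"
  have K: "subgroup ?K G" by (rule subgroup_generate_insert[OF M(1) x(1)])
  have "?K = carrier G"
  proof (rule ccontr)
    assume "?K \<noteq> carrier G"
    then obtain y where y: "y \<in> carrier G" "y \<notin> ?K" using subgroup.subset[OF K] by blast
    let ?L = "generate G (insert y M)"
    have L: "subgroup ?L G" by (rule subgroup_generate_insert[OF M(1) y(1)])
    have yM: "y \<notin> M" using y(2) subset_generate_insert(1)[of M x] by blast
    \<comment> \<open>By the choice of \<open>M\<close>, the strictly larger \<open>?L\<close>
      cannot avoid \<open>x\<close>. It then contains \<open>?K\<close>, which has the same order,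
      contradicting that \<open>y\<close> is outside \<open>?K\<close>.\<close>
    have "x \<in> ?L"
      using max[OF L _ subset_generate_insert(1)] subset_generate_insert(2)[of y M] yM by auto
    then have "?K \<subseteq> ?L"
      using L subset_generate_insert(1)[of M y] by (intro generate_subgroup_incl) auto
    then have "?K = ?L"
      by (rule subgroup_eqI[OF L])
        (simp add: card_adjoin[OF M(1) frat x(1) M(2)] card_adjoin[OF M(1) frat y(1) yM])
    then show False using y(2) subset_generate_insert(2)[of y M] by simp
  qed
  then have "card (carrier G) = p * card M"
    using card_adjoin[OF M(1) frat x(1) M(2)] by simp
  then show thesis using that index_p_imp_maximal[OF M(1) frat] M by blast
qed

text \<open>Induction on the codimension: adjoining \<open>x\<close> to \<open>H\<close> gives a
  subgroup of codimension one less, which is cut back to \<open>H\<close> by a maximal subgroup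
  above \<open>H\<close> that avoids \<open>x\<close>.\<close>

lemma intersection_of_maximals_exists:
  assumes "subgroup H G" "\<Phi> \<subseteq> H" "card (carrier G) = p ^ Suc j * card H"
  shows "intersection_of_maximals G (Suc j) H"
  using assms
proof (induction j arbitrary: H)
  case 0
  then show ?case
    using index_p_imp_maximal[of H] unfolding intersection_of_maximals_def
    by (intro exI[of _ "{H}"]) simp
next
  case (Suc j)
  note H = Suc.prems(1,2)
  have "H \<noteq> carrier G"
    using Suc.prems(3) card_subgroup_pos[OF H(1)] one_less_power[of p "Suc (Suc j)"] by auto
  then obtain x where x: "x \<in> carrier G" "x \<notin> H" using subgroup.subset[OF H(1)] by blast
  let ?K = "generate G (insert x H)"
  have K: "subgroup ?K G" "\<Phi> \<subseteq> ?K"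
    using subgroup_generate_insert[OF H(1) x(1)] subset_generate_insert(1)[of H x] H(2) by auto
  have cardK: "card ?K = p * card H" by (rule card_adjoin[OF H x])
  then have "card (carrier G) = p ^ Suc j * card ?K" using Suc.prems(3) by simp
  then obtain F where F: "finite F" "card F = Suc j" "\<forall>M\<in>F. maximal_subgroup G M" "?K = \<Inter>F"
    using Suc.IH[OF K] by (auto simp: intersection_of_maximals_def)
  obtain M where M: "maximal_subgroup G M" "H \<subseteq> M" "x \<notin> M"
    by (rule maximal_avoiding[OF H x])
  \<comment> \<open>All members of \<open>F\<close> contain \<open>x\<close>, so \<open>M\<close> is
    new and the family has exactly one more member.\<close>
  have "M \<notin> F" using F(4) M(3) subset_generate_insert(2)[of x H] by auto
  moreover have "?K \<inter> M = H"
  proof (intro equalityI subsetI)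
    fix y assume y: "y \<in> ?K \<inter> M"
    show "y \<in> H"
    proof (rule ccontr)
      assume yH: "y \<notin> H"
      have yG: "y \<in> carrier G" using y subgroup.subset[OF K(1)] by blast
      have sub: "generate G (insert y H) \<subseteq> ?K" "generate G (insert y H) \<subseteq> M"
        using y K(1) M(2) maximal_subgroup_imp_subgroup[OF M(1)] subset_generate_insert(1)[of H x]
        by (intro generate_subgroup_incl; auto)+
      \<comment> \<open>No subgroup lies strictly between \<open>H\<close> and \<open>?K\<close>:
        adjoining \<open>y\<close> to \<open>H\<close> gives \<open>?K\<close> by order, which would
        put \<open>x\<close> into \<open>M\<close>.\<close>
      have "generate G (insert y H) = ?K"
        by (rule subgroup_eqI[OF K(1) sub(1)]) (simp add: cardK card_adjoin[OF H yG yH])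
      then show False using sub(2) M(3) subset_generate_insert(2)[of x H] by auto
    qed
  qed (use M(2) subset_generate_insert(1)[of H x] in auto)
  ultimately show ?case
    using F M(1) unfolding intersection_of_maximals_def
    by (intro exI[of _ "insert M F"]) (auto simp: Int_commute)
qed

text \<open>If some \<open>x\<close> in \<open>H\<close> is outside \<open>M\<close>, then
  \<open>x\<close> and \<open>M\<close> generate \<open>G\<close>. Writing elements of
  \<open>H\<close> as \<open>m \<otimes> x [^] k\<close> shows that \<open>H\<close> is generated by
  \<open>x\<close> over \<open>H \<inter> M\<close>.\<close>

lemma card_inter_maximal:
  assumes H: "subgroup H G" "\<Phi> \<subseteq> H" and M: "maximal_subgroup G M"
  shows "card H \<le> p * card (H \<inter> M)"
proof (cases "H \<subseteq> M")
  case True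
  then show ?thesis by (simp add: Int_absorb2)
next
  case False
  then obtain x where x: "x \<in> H" "x \<notin> M" by blast
  have xG: "x \<in> carrier G" using x(1) subgroup.subset[OF H(1)] by blast
  have sM: "subgroup M G" by (rule maximal_subgroup_imp_subgroup[OF M])
  have I: "subgroup (H \<inter> M) G" "\<Phi> \<subseteq> H \<inter> M"
    using subgroups_Inter_pair[OF H(1) sM] H(2) frattini_subset_maximal[OF M] by auto
  have gen: "generate G (insert x M) = carrier G"
    using M x subgroup_generate_insert[OF sM xG] subset_generate_insert(1)[of M x] subset_generate_insert(2)[of x M]
    unfolding maximal_subgroup_def by blast
  have "H \<subseteq> generate G (insert x (H \<inter> M))"
  proof
    fix h assume h: "h \<in> H"
    have "h \<in> generate G (insert x M)" using gen h subgroup.subset[OF H(1)] by blast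
    then obtain m k where mk: "m \<in> M" "h = m \<otimes> x [^] (k::int)"
      unfolding normal.generate_insert[OF normal_if_contains_frattini[OF sM frattini_subset_maximal[OF M]] xG]
      by blast
    have mG: "m \<in> carrier G" using mk(1) subgroup.subset[OF sM] by blast
    \<comment> \<open>Both \<open>h\<close> and \<open>x\<close> are in \<open>H\<close>, hence so
      is the factor \<open>m\<close> from \<open>M\<close>.\<close>
    have "m = h \<otimes> inv (x [^] k)" using mk(2) mG xG by (simp add: m_assoc)
    then have "m \<in> H"
      using h subgroup_int_pow_closed[OF H(1) x(1), of k] H(1)
      by (simp add: subgroup.m_closed subgroup.m_inv_closed)
    then show "h \<in> generate G (insert x (H \<inter> M))"
      unfolding normal.generate_insert[OF normal_if_contains_frattini[OF I] xG]
      using mk by blast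
  qed
  then have "card H \<le> card (generate G (insert x (H \<inter> M)))"
    using finite_subgroup[OF subgroup_generate_insert[OF I(1) xG]] by (rule card_mono[rotated])
  then show ?thesis using card_adjoin[OF I xG] x(2) by simp
qed

text \<open>Each further maximal subgroup costs at most a factor \<open>p\<close>. Intersecting with
  \<open>carrier G\<close> makes the empty family give \<open>G\<close> instead of the whole type,
  so that the induction can start there.\<close>

lemma card_intersection_of_maximals:
  assumes "finite F" "\<forall>M\<in>F. maximal_subgroup G M"
  shows "subgroup (carrier G \<inter> \<Inter>F) G \<and> \<Phi> \<subseteq> carrier G \<inter> \<Inter>F
    \<and> card (carrier G) \<le> p ^ card F * card (carrier G \<inter> \<Inter>F)"
  using assms
proof (induction F rule: finite_induct)
  case empty
  then show ?case using subgroup_self subgroup.subset[OF frattini_subgroup] by simp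
next
  case (insert M F)
  let ?K = "carrier G \<inter> \<Inter>F"
  have K: "subgroup ?K G" "\<Phi> \<subseteq> ?K" "card (carrier G) \<le> p ^ card F * card ?K"
    and M: "maximal_subgroup G M" using insert by auto
  have eq: "carrier G \<inter> \<Inter>(insert M F) = ?K \<inter> M" by auto
  have "card (carrier G) \<le> p ^ card F * card ?K" by (rule K(3))
  also have "\<dots> \<le> p ^ card F * (p * card (?K \<inter> M))"
    using card_inter_maximal[OF K(1,2) M] by (rule mult_left_mono) simp
  also have "\<dots> = p ^ card (insert M F) * card (?K \<inter> M)"
    using insert.hyps by simp
  finally show ?case
    unfolding eq
    using subgroups_Inter_pair[OF K(1) maximal_subgroup_imp_subgroup[OF M]]
      K(2) frattini_subset_maximal[OF M] by auto
qed

lemma intersection_of_maximalsD: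
  assumes "intersection_of_maximals G m H" "0 < m"
  shows "subgroup H G" "\<Phi> \<subseteq> H" "card (carrier G) \<le> p ^ m * card H"
proof -
  obtain F where F: "finite F" "card F = m" "\<forall>M\<in>F. maximal_subgroup G M" "H = \<Inter>F"
    using assms(1) by (auto simp: intersection_of_maximals_def)
  then obtain M where "M \<in> F" using assms(2) by (metis card_gt_0_iff ex_in_conv)
  then have "H \<subseteq> carrier G"
    using F(3,4) maximal_subgroup_imp_subgroup subgroup.subset by blast
  then have "carrier G \<inter> \<Inter>F = H" using F(4) by auto
  then show "subgroup H G" "\<Phi> \<subseteq> H" "card (carrier G) \<le> p ^ m * card H"
    using card_intersection_of_maximals[OF F(1,3)] F(2) by auto
qed

section \<open>Intersection numbers of the levels\<close>

lemma level_frattini_dim: "H \<in> level frattini_dim \<longleftrightarrow> H = carrier G"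
  using subgroup_eqI[OF subgroup_self, of H] card_carrier subgroup_self
    subgroup.subset[OF frattini_subgroup]
  by (auto simp: level_def subgroup.subset)

text \<open>The intersection number is the codimension: so many maximal subgroups suffice by
  construction, and fewer leave an intersection of too large order. The group itself has value 0 by
  convention and is treated separately.\<close>

lemma intersection_number_level:
  assumes H: "H \<in> level k"
  shows "intersection_number G H = Some (frattini_dim - k)"
proof (cases "k = frattini_dim")
  case True
  then show ?thesis using H by (simp add: level_frattini_dim intersection_number_def)
next
  case False
  have k: "k < frattini_dim" using level_le[OF H] False by simp
  have sub: "subgroup H G" "\<Phi> \<subseteq> H" "card H = p ^ k * card \<Phi>"
    using H by (auto simp: level_def)
  have ne: "H \<noteq> carrier G" using sub(3) card_carrier k by auto
  obtain j where j: "frattini_dim - k = Suc j" using k by (cases "frattini_dim - k") auto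
  have "card (carrier G) = p ^ Suc j * card H"
    using card_carrier sub(3) j k by (simp flip: j power_add add: mult.assoc[symmetric])
  then have ex: "intersection_of_maximals G (frattini_dim - k) H"
    using intersection_of_maximals_exists[OF sub(1,2)] j by simp
  have min: "frattini_dim - k \<le> m" if "0 < m" "intersection_of_maximals G m H" for m
  proof -
    have "p ^ frattini_dim * card \<Phi> \<le> p ^ m * (p ^ k * card \<Phi>)"
      using intersection_of_maximalsD(3)[OF that(2,1)] card_carrier sub(3) by simp
    then have "p ^ frattini_dim \<le> p ^ (m + k)" by (simp add: power_add mult.assoc[symmetric])
    then show ?thesis by simp
  qed
  have "(LEAST m. 0 < m \<and> intersection_of_maximals G m H) = frattini_dim - k"
    by (rule Least_equality) (use ex k min in auto)
  moreover have "\<exists>m>0. intersection_of_maximals G m H" using ex k by (intro exI[of _ "frattini_dim - k"]) simp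
  ultimately show ?thesis using ne by (simp add: intersection_number_def)
qed

lemma intersection_number_imp_level:
  assumes "intersection_number G H = Some m"
  obtains k where "H \<in> level k"
proof (cases "H = carrier G")
  case True
  then show thesis using that level_frattini_dim by blast
next
  case False
  then obtain m where "0 < m" "intersection_of_maximals G m H"
    using assms by (auto simp: intersection_number_def split: if_splits)
  then have "subgroup H G" "\<Phi> \<subseteq> H" using intersection_of_maximalsD by auto
  moreover from this obtain k where "card H = p ^ k * card \<Phi>"
    using card_subgroup_frattini_multiple by blast
  ultimately have "H \<in> level k" by (simp add: level_def)
  then show thesis by (rule that)
qed

lemma intersection_number_iff:
  assumes "k \<le> frattini_dim"
  shows "subgroup H G \<and> intersection_number G H = Some (frattini_dim - k) \<longleftrightarrow> H \<in> level k"
proof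
  assume "H \<in> level k"
  then show "subgroup H G \<and> intersection_number G H = Some (frattini_dim - k)"
    using intersection_number_level by (simp add: level_def)
next
  assume "subgroup H G \<and> intersection_number G H = Some (frattini_dim - k)"
  moreover from this obtain l where l: "H \<in> level l" using intersection_number_imp_level by blast
  ultimately have "frattini_dim - l = frattini_dim - k" using intersection_number_level by auto
  \<comment> \<open>Both \<open>l\<close> and \<open>k\<close> are at most
    \<open>frattini_dim\<close>, so the truncated differences can be cancelled.\<close>
  then have "l = k" using level_le[OF l] assms by simp
  then show "H \<in> level k" using l by simp
qed

section \<open>The quotient by the Frattini subgroup as a vector space\<close>

lemma card_eq_dim_mod_frattini:
  assumes H: "subgroup H G" "\<Phi> \<subseteq> H"
  shows "card H = p ^ dim_mod_frattini p G H * card \<Phi>"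
proof -
  let ?H = "G\<lparr>carrier := H\<rparr>"
  let ?A = "?H Mod \<Phi>"
  interpret H: group ?H by (rule subgroup_imp_group[OF H(1)])
  have sub: "subgroup \<Phi> ?H" by (rule subgroup_incl[OF frattini_subgroup H])
  interpret N: normal \<Phi> ?H
    by (rule normal_restrict_supergroup[OF H(1) normal_if_contains_frattini[OF frattini_subgroup] H(2)]) simp
  have HG: "x \<in> carrier G" if "x \<in> H" for x using that subgroup.subset[OF H(1)] by blast
  interpret A: group ?A by (rule N.factorgroup_is_group)
  have A_elem: "\<exists>x\<in>H. X = \<Phi> #> x" if "X \<in> carrier ?A" for X
    using that by (auto simp: carrier_FactGroup)
  have "X \<otimes>\<^bsub>?A\<^esub> Y = Y \<otimes>\<^bsub>?A\<^esub> X" if XY: "X \<in> carrier ?A" "Y \<in> carrier ?A" for X Y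
  proof -
    obtain x y where xy: "x \<in> H" "X = \<Phi> #> x" "y \<in> H" "Y = \<Phi> #> y" using A_elem XY by metis
    have "X \<otimes>\<^bsub>?A\<^esub> Y = \<Phi> #> (x \<otimes> y)" "Y \<otimes>\<^bsub>?A\<^esub> X = \<Phi> #> (y \<otimes> x)"
      using N.rcos_sum[of x y] N.rcos_sum[of y x] xy by auto
    moreover have "\<Phi> #> (x \<otimes> y) = \<Phi> #> (y \<otimes> x)"
    proof (rule repr_independence[symmetric, OF _ _ frattini_subgroup])
      have xyG: "x \<in> carrier G" "y \<in> carrier G" using xy HG by auto
      have "inv y \<otimes> (y \<otimes> x) = x" using xyG by (simp flip: m_assoc)
      \<comment> \<open>The two products differ by a commutator, which lies in \<Phi>; so the
        quotient is abelian.\<close>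
      then have "x \<otimes> y = x \<otimes> y \<otimes> inv x \<otimes> inv y \<otimes> (y \<otimes> x)"
        using xyG by (simp add: m_assoc)
      then show "x \<otimes> y \<in> \<Phi> #> (y \<otimes> x)"
        using commutator_in_frattini[OF xyG] by (auto simp: r_coset_def)
      show "y \<otimes> x \<in> carrier G" using xyG by simp
    qed
    ultimately show ?thesis by simp
  qed
  then have comm: "comm_group ?A" by (rule A.group_comm_groupI)
  have exp: "X [^]\<^bsub>?A\<^esub> p = \<one>\<^bsub>?A\<^esub>" if X: "X \<in> carrier ?A" for X
  proof -
    obtain x where x: "x \<in> H" "X = \<Phi> #> x" using A_elem X by blast
    have "X [^]\<^bsub>?A\<^esub> p = \<Phi> #> (x [^] p)"
      using N.FactGroup_pow[of x p] x by (simp flip: nat_pow_consistent)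
    also have "\<dots> = \<Phi>"
      using coset_join2[OF _ frattini_subgroup pow_in_frattini] HG[OF x(1)] by simp
    finally show ?thesis by simp
  qed
  interpret V: vectorspace "residue_ring (int p)" "fp_space ?A"
    by (rule fp_space_vectorspace[OF p comm exp])
  \<comment> \<open>Lagrange gives the order of the quotient, and as a vector space over the field
    with \<open>p\<close> elements it has \<open>p\<close> to the power of its dimension
    elements.\<close>
  have "card (carrier ?A) * card \<Phi> = card H"
    using H.lagrange[OF sub] by (simp add: FactGroup_def order_def)
  moreover have "finite (carrier ?A)"
    using finite_subgroup[OF H(1)] by (simp add: carrier_FactGroup)
  then have "card (carrier ?A) = p ^ dim_mod_frattini p G H"
    using V.card_carrier_eq_power_dim
    by (simp add: fp_space_def dim_mod_frattini_def residue_ring_def)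
  ultimately show ?thesis by simp
qed

end

section \<open>Reduction of the three counts to the levels\<close>

theorem theorem3p3:
  fixes G :: "('a, 'b) monoid_scheme" and p n :: nat
  assumes "prime p"
    and "finite_p_group p G"
    and "group_rank G = n"
  shows "of_nat (card {H. subgroup H G \<and> frattini G \<subseteq> H}) = gaussian_sum p n
    \<and> (\<forall>k\<le>n. of_nat (card {H. subgroup H G \<and> intersection_number G H = Some (n - k)})
           = gaussian_binomial p n k)
    \<and> (\<forall>k\<le>n. of_nat (card {H. subgroup H G \<and> frattini G \<subseteq> H \<and> dim_mod_frattini p G H = k})
           = gaussian_binomial p n k)"
proof -
  interpret group G using assms(2) by (simp add: finite_p_group_def)
  obtain a where "Coset.order G = p ^ a" using assms(2) by (auto simp: finite_p_group_def)
  then interpret p_group G p a using assms(1) by unfold_locales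
  have n: "n = frattini_dim" using assms(3) group_rank_eq by simp
  \<comment> \<open>Since \<open>p > 1\<close> and \<Phi> is nonempty, the order
    \<open>p ^ k * card \<Phi>\<close> determines \<open>k\<close>, so fixing the dimension is the
    same as fixing the order.\<close>
  have level_dim: "{H. subgroup H G \<and> frattini G \<subseteq> H \<and> dim_mod_frattini p G H = k} = level k" for k
    using card_eq_dim_mod_frattini by (auto simp: level_def)
  have level_inum: "{H. subgroup H G \<and> intersection_number G H = Some (n - k)} = level k"
    if "k \<le> n" for k
    using intersection_number_iff that n by blast
  show ?thesis
    using level_inum card_level
    by (simp add: level_dim card_subgroups_eq_sum gaussian_sum_def n)
qed

end
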